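(* Let $A=\{\mathbf{a}_1,\ldots,\mathbf{a}_p\}\subset\mathbb{N}^n$ and let $B=\{\mathbf{b}\}\subset\mathbb{N}^n$ have only one element. Then $\langle A\rangle$ and $\langle B\rangle$ can be glued if and only if a positive integer multiple of $\mathbf{b}$ belongs to $\langle A\rangle$, equivalently, if and only if the system $A\cdot X=d\,\mathbf{b}$ has a solution $X\in\mathbb{N}^p$ for some integer $d\geq 1$.
   Context: Here $\mathbb{N}=\{0,1,2,\ldots\}$, $n\ge 1$, and $k$ is an arbitrary field. All generators of semigroups are nonzero vectors. For $A=\{\mathbf{a}_1,\ldots,\mathbf{a}_p\}\subset\mathbb{N}^n$, $\langle A\rangle$ is the semigroup of all $\mathbb{N}$-linear combinations of elements of $A$, and $A$ also denotes the $n\times p$ integer matrix with columns $\mathbf{a}_1,\ldots,\mathbf{a}_p$. $I_A$ is the kernel of the $k$-algebra map $k[x_1,\ldots,x_p]\to k[t_1,\ldots,t_n]$, $x_j\mapsto t^{\mathbf{a}_j}=\prod_{i=1}^n t_i^{a_{ij}}$. For $B=\{\mathbf{b}\}$ the variable is $y$, and $I_B=(0)\subset k[y]$. For positive integers $k_1,k_2$ and $C=k_1A\cup\{k_2\mathbf{b}\}$, let $I_C\subset R=k[x_1,\ldots,x_p,y]$ be the kernel of the $k$-algebra map $R\to k[t_1,\ldots,t_n]$, $x_i\mapsto t^{k_1\mathbf{a}_i}$, $y\mapsto t^{k_2\mathbf{b}}$. One says that $\langle C\rangle$ is a gluing of $\langle A\rangle$ and $\langle B\rangle$ if $I_C=I_AR+\langle\rho\rangle$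 for some nonzero binomial $\rho=x_1^{\alpha_1}\cdots x_p^{\alpha_p}-y^{\beta}$ with $\alpha\in\mathbb{N}^p$, $\beta\in\mathbb{N}$. The semigroups $\langle A\rangle$ and $\langle B\rangle$ can be glued if there exist positive integers $k_1,k_2$ such that, for $C=k_1A\cup\{k_2\mathbf{b}\}$, $\langle C\rangle$ is a gluing of $\langle A\rangle$ and $\langle B\rangle$. *)

theory Defs
  imports "HOL-Analysis.Analysis" "HOL-Library.Poly_Mapping" "HOL-Library.Set_Algebras"
begin

text \<open>Exponent vectors are finitely supported maps \<open>'v \<Rightarrow>\<^sub>0 nat\<close>; the product on
  \<open>('v \<Rightarrow>\<^sub>0 nat) \<Rightarrow>\<^sub>0 'k\<close> is convolution, so this type is the polynomial ring over \<open>'k\<close>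
  with variables indexed by \<open>'v\<close>.\<close>

type_synonym ('v, 'k) mpoly = "('v \<Rightarrow>\<^sub>0 nat) \<Rightarrow>\<^sub>0 'k"

definition Const :: "'k::field \<Rightarrow> ('v, 'k) mpoly" where
  "Const c = Poly_Mapping.single 0 c"

definition Var :: "'v \<Rightarrow> ('v, 'k::field) mpoly" where
  "Var v = Poly_Mapping.single (Poly_Mapping.single v 1) 1"

definition vec_monom :: "nat ^ 'v::finite \<Rightarrow> ('v, 'k::field) mpoly" where
  "vec_monom a = (\<Prod>i\<in>UNIV. Var i ^ (a $ i))"

text \<open>The unique \<open>'k\<close>-algebra map sending \<open>Var v\<close> to \<open>f v\<close>.\<close>

definition subst_poly ::
    "('v \<Rightarrow> ('w, 'k) mpoly) \<Rightarrow> ('v, 'k::field) mpoly \<Rightarrow> ('w, 'k) mpoly" where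
  "subst_poly f P =
     (\<Sum>m\<in>Poly_Mapping.keys P. Const (Poly_Mapping.lookup P m) *
        (\<Prod>v\<in>Poly_Mapping.keys m. f v ^ Poly_Mapping.lookup m v))"

text \<open>The ideals of a commutative ring are its submodules as a module over itself.\<close>

definition ideal_gen :: "'a::comm_ring_1 set \<Rightarrow> 'a set" where
  "ideal_gen S = module.span (*) S"

definition semigroup_gen :: "(nat ^ 'n::finite) set \<Rightarrow> (nat ^ 'n) set" where
  "semigroup_gen S = {\<Sum>a\<in>F. c a *s a |F c. finite F \<and> F \<subseteq> S}"

text \<open>A finite generating family is given by the matrix whose columns are the generators.\<close>

definition toric_ideal :: "nat ^ 'v::finite ^ 'n::finite \<Rightarrow> ('v, 'k::field) mpoly set" where
  "toric_ideal M = {P. subst_poly (\<lambda>j. vec_monom (column j M) :: ('n, 'k) mpoly) P = 0}"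

text \<open>In \<open>'p option\<close>, the index \<open>Some j\<close> stands for \<open>x\<^sub>j\<close> and \<open>None\<close> for \<open>y\<close>.\<close>

definition joint_matrix ::
    "nat \<Rightarrow> nat ^ 'p::finite ^ 'n::finite \<Rightarrow> nat \<Rightarrow> nat ^ 'n \<Rightarrow> nat ^ 'p option ^ 'n" where
  "joint_matrix k1 A k2 b =
     (\<chi> i j. case j of Some l \<Rightarrow> k1 * A $ i $ l | None \<Rightarrow> k2 * b $ i)"

definition glue_binomial :: "nat ^ 'p::finite \<Rightarrow> nat \<Rightarrow> ('p option, 'k::field) mpoly" where
  "glue_binomial \<alpha> \<beta> = (\<Prod>j\<in>UNIV. Var (Some j) ^ (\<alpha> $ j)) - Var None ^ \<beta>"

text \<open>The ideal \<open>I\<^sub>A R\<close> is generated by the image of \<open>I\<^sub>A\<close> under the inclusion of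
  \<open>k[x\<^sub>1, \<dots>, x\<^sub>p]\<close> into \<open>R = k[x\<^sub>1, \<dots>, x\<^sub>p, y]\<close>. The ideal of a single generator \<open>b \<noteq> 0\<close>
  is zero and contributes nothing. The outer \<open>+\<close> is the elementwise sum of sets.\<close>

definition is_gluing ::
    "'k::field itself \<Rightarrow> nat \<Rightarrow> nat ^ 'p::finite ^ 'n::finite \<Rightarrow> nat \<Rightarrow> nat ^ 'n \<Rightarrow> bool" where
  "is_gluing K k1 A k2 b \<longleftrightarrow>
     (\<exists>\<alpha> \<beta>. (glue_binomial \<alpha> \<beta> :: ('p option, 'k) mpoly) \<noteq> 0 \<and>
        (toric_ideal (joint_matrix k1 A k2 b) :: ('p option, 'k) mpoly set) =
          ideal_gen (subst_poly (\<lambda>j. Var (Some j)) ` toric_ideal A)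
            + ideal_gen {glue_binomial \<alpha> \<beta>})"

definition can_be_glued ::
    "'k::field itself \<Rightarrow> nat ^ 'p::finite ^ 'n::finite \<Rightarrow> nat ^ 'n \<Rightarrow> bool" where
  "can_be_glued K A b \<longleftrightarrow> (\<exists>k1 > 0. \<exists>k2 > 0. is_gluing K k1 A k2 b)"

end

theory Submission
  imports Defs
begin

text \<open>If \<open>A X = d b\<close> with \<open>d \<ge> 1\<close>, take \<open>k\<^sub>1 = 1\<close>, \<open>k\<^sub>2 = d\<close> and \<open>\<rho> = x\<^sup>X - y\<close>: substituting
  \<open>x\<^sup>X\<close> for \<open>y\<close> changes a polynomial only by a multiple of \<open>\<rho>\<close> and carries \<open>I\<^sub>C\<close> into \<open>I\<^sub>A\<close>.
  Conversely, \<open>\<rho> = x\<^sup>\<alpha> - y\<^sup>\<beta> \<in> I\<^sub>C\<close> says \<open>A (k\<^sub>1 \<alpha>) = k\<^sub>2 \<beta> b\<close>, and \<open>\<beta> = 0\<close> would force \<open>\<alpha> = 0\<close>,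
  hence \<open>\<rho> = 0\<close>, because no column of \<open>A\<close> vanishes.\<close>

section \<open>Substitution is a ring homomorphism\<close>

text \<open>Updating at a key outside the support is the same as adding a \<open>single\<close>
  there. The rule serves both layers of the polynomial type: terms of a polynomial and variables of
  an exponent vector.\<close>

lemma poly_mapping_single_add_induct [case_names zero add]:
  assumes "P 0"
    and "\<And>a b f. b \<noteq> 0 \<Longrightarrow> P f \<Longrightarrow> P (Poly_Mapping.single a b + f)"
  shows "P (f :: 'a \<Rightarrow>\<^sub>0 'b::comm_monoid_add)"
proof (induction f rule: update_induct)
  case const
  show ?case by (fact assms(1))
next
  case (update f a b)
  have "Poly_Mapping.update a b f = Poly_Mapping.single a b + f"
    using update.hyps by (intro poly_mapping_eqI)
      (auto simp: lookup_update lookup_add lookup_single when_def in_keys_iff)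
  then show ?case
    using assms(2) update by simp
qed

lemma Var_power: "Var v ^ n = Poly_Mapping.single (Poly_Mapping.single v n) 1"
proof (induction n)
  case (Suc n)
  have "Poly_Mapping.single v 1 + Poly_Mapping.single v n = Poly_Mapping.single v (Suc n)"
    by (simp flip: single_add)
  then show ?case
    using Suc by (simp add: Var_def mult_single)
qed simp

lemma Const_0 [simp]: "Const 0 = 0"
  by (simp add: Const_def)

lemma Const_1 [simp]: "Const 1 = 1"
  by (simp add: Const_def)

lemma Const_add: "Const (a + b) = Const a + Const b"
  by (simp add: Const_def single_add)

lemma Const_mult: "Const (a * b) = Const a * Const b"
  by (simp add: Const_def mult_single)

text \<open>Constants and variables generate the ring, so facts about homomorphisms need checking
  only on them. The outer induction splits off terms, the inner one splits off powers of
  variables.\<close>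

lemma mpoly_induct [case_names Const Var add mult]:
  assumes C: "\<And>c. P (Const c)" and V: "\<And>v. P (Var v)"
    and add: "\<And>p q. P p \<Longrightarrow> P q \<Longrightarrow> P (p + q)"
    and mult: "\<And>p q. P p \<Longrightarrow> P q \<Longrightarrow> P (p * q)"
  shows "P (p :: ('v, 'k::field) mpoly)"
proof (induction p rule: poly_mapping_single_add_induct)
  case zero
  show ?case using C[of 0] by simp
next
  case (add m c p)
  have pow: "P (Var v ^ n)" for v n
    by (induction n) (use C[of 1] V mult in simp_all)
  have "P (Poly_Mapping.single m c)"
  proof (induction m rule: poly_mapping_single_add_induct)
    case zero
    show ?case using C[of c] by (simp add: Const_def)
  next
    case (add v n m)
    have "Poly_Mapping.single (Poly_Mapping.single v n + m) c = Var v ^ n * Poly_Mapping.single m c"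
      by (simp add: Var_power mult_single)
    then show ?case
      using mult[OF pow add.IH] by simp
  qed
  then show ?case
    using add.IH assms(3) by blast
qed

definition subst_monom :: "('v \<Rightarrow> ('w, 'k) mpoly) \<Rightarrow> ('v \<Rightarrow>\<^sub>0 nat) \<Rightarrow> ('w, 'k::field) mpoly" where
  "subst_monom f m = (\<Prod>v\<in>Poly_Mapping.keys m. f v ^ Poly_Mapping.lookup m v)"

lemma subst_monom_superset:
  assumes "finite S" "Poly_Mapping.keys m \<subseteq> S"
  shows "subst_monom f m = (\<Prod>v\<in>S. f v ^ Poly_Mapping.lookup m v)"
  unfolding subst_monom_def using assms
  by (intro prod.mono_neutral_left) (auto simp: in_keys_iff)

lemma subst_monom_add: "subst_monom f (m + m') = subst_monom f m * subst_monom f m'"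
proof -
  let ?S = "Poly_Mapping.keys m \<union> Poly_Mapping.keys m'"
  have "subst_monom f (m + m') = (\<Prod>v\<in>?S. f v ^ Poly_Mapping.lookup (m + m') v)"
    by (intro subst_monom_superset keys_add) simp
  also have "\<dots> = (\<Prod>v\<in>?S. f v ^ Poly_Mapping.lookup m v) * (\<Prod>v\<in>?S. f v ^ Poly_Mapping.lookup m' v)"
    by (simp add: lookup_add power_add prod.distrib)
  also have "\<dots> = subst_monom f m * subst_monom f m'"
    by (simp add: subst_monom_superset[of ?S])
  finally show ?thesis .
qed

text \<open>Cancellation can make the support of \<open>p + q\<close> smaller than the union of the
  supports. Summing over any finite superset is harmless, since the extra terms have coefficient 0,
  and it puts \<open>p\<close>, \<open>q\<close> and \<open>p + q\<close> on one index set.\<close>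

lemma subst_poly_superset:
  assumes "finite S" "Poly_Mapping.keys p \<subseteq> S"
  shows "subst_poly f p = (\<Sum>m\<in>S. Const (Poly_Mapping.lookup p m) * subst_monom f m)"
  unfolding subst_poly_def subst_monom_def[symmetric] using assms
  by (intro sum.mono_neutral_left) (auto simp: in_keys_iff)

lemma subst_poly_single: "subst_poly f (Poly_Mapping.single m c) = Const c * subst_monom f m"
  by (subst subst_poly_superset[of "{m}"]) (auto split: if_splits)

lemma subst_poly_add: "subst_poly f (p + q) = subst_poly f p + subst_poly f q"
proof -
  let ?S = "Poly_Mapping.keys p \<union> Poly_Mapping.keys q"
  have "subst_poly f (p + q) = (\<Sum>m\<in>?S. Const (Poly_Mapping.lookup (p + q) m) * subst_monom f m)"
    by (intro subst_poly_superset keys_add) simp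
  then show ?thesis
    by (simp add: subst_poly_superset[of ?S] lookup_add Const_add distrib_right sum.distrib)
qed

lemma subst_poly_0 [simp]: "subst_poly f 0 = 0"
  by (simp add: subst_poly_def)

text \<open>By additivity in each factor, the claim reduces to a product of two single terms, where
  it is \<open>subst_monom_add\<close>.\<close>

lemma subst_poly_mult: "subst_poly f (p * q) = subst_poly f p * subst_poly f q"
proof (induction p rule: poly_mapping_single_add_induct)
  case (add m c p)
  have "subst_poly f (Poly_Mapping.single m c * q)
      = subst_poly f (Poly_Mapping.single m c) * subst_poly f q"
  proof (induction q rule: poly_mapping_single_add_induct)
    case (add m' c' q)
    then show ?case
      by (simp add: distrib_left subst_poly_add mult_single subst_poly_single subst_monom_add
          Const_mult mult_ac)
  qed simp
  with add show ?case
    by (simp add: distrib_right subst_poly_add)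
qed simp

lemma subst_poly_Const [simp]: "subst_poly f (Const c) = Const c"
  by (subst Const_def) (simp add: subst_poly_single subst_monom_def)

lemma subst_poly_1 [simp]: "subst_poly f 1 = 1"
  using subst_poly_Const[of f 1] by simp

lemma subst_poly_Var [simp]: "subst_poly f (Var v) = f v"
  unfolding Var_def by (simp add: subst_poly_single subst_monom_def)

lemma subst_poly_diff: "subst_poly f (p - q) = subst_poly f p - subst_poly f q"
  using subst_poly_add[of f "p - q" q] by (simp add: algebra_simps)

lemma subst_poly_power: "subst_poly f (p ^ n) = subst_poly f p ^ n"
  by (induction n) (simp_all add: subst_poly_mult)

lemma subst_poly_prod: "subst_poly f (\<Prod>i\<in>S. g i) = (\<Prod>i\<in>S. subst_poly f (g i))"
  by (induction S rule: infinite_finite_induct) (simp_all add: subst_poly_mult)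

lemma subst_poly_subst_poly:
  "subst_poly g (subst_poly f p) = subst_poly (\<lambda>v. subst_poly g (f v)) p"
  by (induction p rule: mpoly_induct) (simp_all add: subst_poly_add subst_poly_mult)

lemma subst_poly_Var_id: "subst_poly Var p = p"
  by (induction p rule: mpoly_induct) (simp_all add: subst_poly_add subst_poly_mult)

section \<open>Ideals\<close>

lemma module_self: "module ((*) :: 'a::comm_ring_1 \<Rightarrow> 'a \<Rightarrow> 'a)"
  by unfold_locales (simp_all add: algebra_simps)

lemmas ideal_gen_base = module.span_base[OF module_self, folded ideal_gen_def]
  and ideal_gen_0 = module.span_zero[OF module_self, folded ideal_gen_def]
  and ideal_gen_add = module.span_add[OF module_self, folded ideal_gen_def]
  and ideal_gen_mult = module.span_scale[OF module_self, folded ideal_gen_def]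
  and ideal_gen_minimal = module.span_minimal[OF module_self, folded ideal_gen_def]

text \<open>Two algebra maps that are congruent modulo an ideal on the variables are congruent on
  all polynomials.\<close>

lemma subst_poly_diff_in_ideal:
  assumes "\<And>v. f v - g v \<in> ideal_gen S"
  shows "subst_poly f p - subst_poly g p \<in> ideal_gen S"
proof (induction p rule: mpoly_induct)
  case (Const c)
  show ?case by (simp add: ideal_gen_0)
next
  case (Var v)
  show ?case using assms by simp
next
  case (add p q)
  have "subst_poly f (p + q) - subst_poly g (p + q)
      = (subst_poly f p - subst_poly g p) + (subst_poly f q - subst_poly g q)"
    by (simp add: subst_poly_add)
  then show ?case
    using ideal_gen_add[OF add] by simp
next
  case (mult p q)
  \<comment> \<open>The mixed product \<open>subst_poly f q * subst_poly g p\<close> is subtracted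
    and added back.\<close>
  have "subst_poly f (p * q) - subst_poly g (p * q)
      = subst_poly f q * (subst_poly f p - subst_poly g p)
        + subst_poly g p * (subst_poly f q - subst_poly g q)"
    by (simp add: subst_poly_mult algebra_simps)
  then show ?case
    using ideal_gen_add[OF ideal_gen_mult[OF mult(1)] ideal_gen_mult[OF mult(2)]] by simp
qed

lemma subspace_toric_ideal: "module.subspace (*) (toric_ideal M)"
  by (simp add: module.subspace_def[OF module_self] toric_ideal_def subst_poly_add subst_poly_mult)

section \<open>Monomials\<close>

lemma vec_monom_0 [simp]: "vec_monom 0 = 1"
  by (simp add: vec_monom_def)

lemma vec_monom_add: "vec_monom (a + b) = vec_monom a * vec_monom b"
  by (simp add: vec_monom_def power_add prod.distrib)

lemma vec_monom_scale: "vec_monom (n *s a) = vec_monom a ^ n"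
  by (simp add: vec_monom_def prod_power_distrib mult.commute flip: power_mult)

lemma vec_monom_sum: "vec_monom (\<Sum>i\<in>S. a i) = (\<Prod>i\<in>S. vec_monom (a i))"
  by (induction S rule: infinite_finite_induct) (simp_all add: vec_monom_add)

lemma vec_monom_matrix_mult: "vec_monom (A *v x) = (\<Prod>j\<in>UNIV. vec_monom (column j A) ^ (x $ j))"
  by (simp add: matrix_mult_sum vec_monom_sum vec_monom_scale)

lemma vec_monom_eq_single:
  "(vec_monom a :: ('v::finite, 'k::field) mpoly) = Poly_Mapping.single (\<Sum>i\<in>UNIV. Poly_Mapping.single i (a $ i)) 1"
proof -
  have "(\<Prod>i\<in>S. Poly_Mapping.single (m i) (1::'k)) = Poly_Mapping.single (\<Sum>i\<in>S. m i) 1"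
    if "finite S" for S :: "'v set" and m :: "'v \<Rightarrow> ('v \<Rightarrow>\<^sub>0 nat)"
    using that by induction (simp_all add: mult_single)
  then show ?thesis
    by (simp add: vec_monom_def Var_power)
qed

text \<open>A monomial is a single term with coefficient 1, which is nonzero in every field, so its
  support reveals the exponent.\<close>

lemma vec_monom_inject:
  assumes "(vec_monom a :: ('v::finite, 'k::field) mpoly) = vec_monom b"
  shows "a = b"
proof -
  have "Poly_Mapping.keys (vec_monom a :: ('v, 'k) mpoly) = Poly_Mapping.keys (vec_monom b :: ('v, 'k) mpoly)"
    using assms by simp
  then have "(\<Sum>i\<in>UNIV. Poly_Mapping.single i (a $ i)) = (\<Sum>i\<in>UNIV. Poly_Mapping.single i (b $ i))"
    by (simp add: vec_monom_eq_single)
  then have "Poly_Mapping.lookup (\<Sum>i\<in>UNIV. Poly_Mapping.single i (a $ i)) i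
      = Poly_Mapping.lookup (\<Sum>i\<in>UNIV. Poly_Mapping.single i (b $ i)) i" for i
    by simp
  then show ?thesis
    by (simp add: vec_eq_iff lookup_sum lookup_single when_def)
qed

section \<open>Gluing\<close>

lemma column_joint_matrix [simp]:
  "column (Some j) (joint_matrix k1 A k2 b) = k1 *s column j A"
  "column None (joint_matrix k1 A k2 b) = k2 *s b"
  by (simp_all add: joint_matrix_def column_def vec_eq_iff)

text \<open>This turns ideal membership into linear algebra: the toric map sends both parts of the
  binomial to monomials, and monomials agree only when their exponents do.\<close>

lemma glue_binomial_in_toric_ideal_iff:
  fixes A :: "nat ^ 'p::finite ^ 'n::finite"
  shows "(glue_binomial \<alpha> \<beta> :: ('p option, 'k::field) mpoly) \<in> toric_ideal (joint_matrix k1 A k2 b)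
    \<longleftrightarrow> A *v (k1 *s \<alpha>) = (k2 * \<beta>) *s b"
proof -
  have "subst_poly (\<lambda>j. vec_monom (column j (joint_matrix k1 A k2 b)) :: ('n, 'k) mpoly)
      (glue_binomial \<alpha> \<beta>) = vec_monom (A *v (k1 *s \<alpha>)) - vec_monom ((k2 * \<beta>) *s b)"
    by (simp add: glue_binomial_def subst_poly_diff subst_poly_prod subst_poly_power
        vec_monom_matrix_mult vec_monom_scale power_mult)
  then show ?thesis
    by (auto simp: toric_ideal_def dest: vec_monom_inject)
qed

lemma glue_binomial_eq_vec_monom:
  "(glue_binomial \<alpha> \<beta> :: ('p::finite option, 'k::field) mpoly) = vec_monom (\<chi> i. case i of Some j \<Rightarrow> \<alpha> $ j | None \<Rightarrow> 0)
     - vec_monom (\<chi> i. case i of Some j \<Rightarrow> 0 | None \<Rightarrow> \<beta>)"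
proof -
  have "(\<Prod>i\<in>UNIV. h i) = h None * (\<Prod>j\<in>UNIV. h (Some j))"
    for h :: "'p option \<Rightarrow> ('p option, 'k) mpoly"
    by (simp add: UNIV_option_conv prod.reindex)
  then show ?thesis
    by (simp add: glue_binomial_def vec_monom_def)
qed

text \<open>The two monomials share no variable, so they can coincide only when both are 1.\<close>

lemma glue_binomial_eq_0_iff:
  "(glue_binomial \<alpha> \<beta> :: ('p::finite option, 'k::field) mpoly) = 0 \<longleftrightarrow> \<alpha> = 0 \<and> \<beta> = 0"
proof
  assume "(glue_binomial \<alpha> \<beta> :: ('p option, 'k) mpoly) = 0"
  then have eq: "(\<chi> i. case i of Some j \<Rightarrow> \<alpha> $ j | None \<Rightarrow> 0) = (\<chi> i. case i of Some j \<Rightarrow> 0 | None \<Rightarrow> \<beta>)"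
    unfolding glue_binomial_eq_vec_monom right_minus_eq by (rule vec_monom_inject)
  have "\<alpha> $ j = 0" for j
    using arg_cong[OF eq, of "\<lambda>v. v $ Some j"] by simp
  moreover have "\<beta> = 0"
    using arg_cong[OF eq, of "\<lambda>v. v $ None"] by simp
  ultimately show "\<alpha> = 0 \<and> \<beta> = 0"
    by (simp add: vec_eq_iff)
qed (simp add: glue_binomial_def)

section \<open>Necessity: from the gluing binomial to the linear system\<close>

lemma can_be_glued_imp_solution:
  fixes A :: "nat ^ 'p::finite ^ 'n::finite"
  assumes "\<And>j. column j A \<noteq> 0" and "can_be_glued TYPE('k::field) A b"
  shows "\<exists>d\<ge>1. \<exists>X. A *v X = d *s b"
proof -
  from assms(2) obtain k1 k2 \<alpha> \<beta> where k: "k1 > 0" "k2 > 0"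
    and nz: "(glue_binomial \<alpha> \<beta> :: ('p option, 'k) mpoly) \<noteq> 0"
    and eq: "(toric_ideal (joint_matrix k1 A k2 b) :: ('p option, 'k) mpoly set) =
      ideal_gen (subst_poly (\<lambda>j. Var (Some j)) ` toric_ideal A) + ideal_gen {glue_binomial \<alpha> \<beta>}"
    by (auto simp: can_be_glued_def is_gluing_def)
  \<comment> \<open>The summand 0, taken from the extension of the toric ideal of \<open>A\<close>,
    exhibits the binomial as an element of the sum of sets.\<close>
  have "0 + glue_binomial \<alpha> \<beta> \<in> (toric_ideal (joint_matrix k1 A k2 b) :: ('p option, 'k) mpoly set)"
    unfolding eq by (intro set_plus_intro ideal_gen_0 ideal_gen_base) simp
  then have sol: "A *v (k1 *s \<alpha>) = (k2 * \<beta>) *s b"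
    by (simp add: glue_binomial_in_toric_ideal_iff)
  have "\<beta> \<noteq> 0"
  proof
    assume "\<beta> = 0"
    \<comment> \<open>For \<beta> = 0 the right side vanishes, and a sum of natural numbers is 0
      only if each summand is.\<close>
    with sol k(1) have "\<forall>i j. A $ i $ j = 0 \<or> \<alpha> $ j = 0"
      by (simp add: vec_eq_iff matrix_vector_mult_def)
    moreover have "\<exists>i. A $ i $ j \<noteq> 0" for j
      using assms(1)[of j] by (auto simp: vec_eq_iff column_def)
    ultimately have "\<alpha> = 0"
      by (metis vec_eq_iff zero_index)
    with \<open>\<beta> = 0\<close> nz show False
      by (simp add: glue_binomial_eq_0_iff)
  qed
  with k(2) have "k2 * \<beta> \<ge> 1"
    by simp
  with sol show ?thesis
    by blast
qed

section \<open>Sufficiency: eliminating the variable y\<close>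

lemma solution_imp_can_be_glued:
  fixes A :: "nat ^ 'p::finite ^ 'n::finite"
  assumes "d \<ge> 1" and sol: "A *v X = d *s b"
  shows "can_be_glued TYPE('k::field) A b"
proof -
  define \<rho> :: "('p option, 'k) mpoly" where "\<rho> = glue_binomial X 1"
  let ?\<iota> = "subst_poly (\<lambda>j. Var (Some j)) :: ('p, 'k) mpoly \<Rightarrow> ('p option, 'k) mpoly"
  let ?\<phi> = "subst_poly (case_option (vec_monom X) Var) :: ('p option, 'k) mpoly \<Rightarrow> ('p, 'k) mpoly"
  let ?IC = "toric_ideal (joint_matrix 1 A d b) :: ('p option, 'k) mpoly set"
  have \<rho>_in: "\<rho> \<in> ?IC"
    unfolding \<rho>_def glue_binomial_in_toric_ideal_iff using sol by (simp add: vector_scalar_mult_def)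
  \<comment> \<open>The toric map of \<open>A\<close> after \<open>?\<phi>\<close> is the toric map
    of the joint matrix. It suffices to compare them on variables, and at y this is exactly
    \<open>sol\<close>.\<close>
  have \<phi>_in: "?\<phi> p \<in> toric_ideal A" if "p \<in> ?IC" for p
  proof -
    have "subst_poly (\<lambda>j. vec_monom (column j A)) (case_option (vec_monom X) Var v)
        = (vec_monom (column v (joint_matrix 1 A d b)) :: ('n, 'k) mpoly)" for v
    proof (cases v)
      case None
      have "subst_poly (\<lambda>j. vec_monom (column j A)) (vec_monom X) = (vec_monom (A *v X) :: ('n, 'k) mpoly)"
        by (simp add: vec_monom_matrix_mult) (simp add: vec_monom_def subst_poly_prod subst_poly_power)
      with None sol show ?thesis by simp
    qed (simp add: vector_scalar_mult_def)
    with that show ?thesis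
      by (simp add: toric_ideal_def subst_poly_subst_poly)
  qed
  \<comment> \<open>Since the multiplier of \<open>A\<close> is 1, the toric map of the joint matrix
    restricts on the x variables to that of \<open>A\<close>.\<close>
  have \<iota>_in: "?\<iota> q \<in> ?IC" if "q \<in> toric_ideal A" for q
    using that by (simp add: toric_ideal_def subst_poly_subst_poly vector_scalar_mult_def)
  \<comment> \<open>Both the identity and \<open>?\<iota>\<close> after \<open>?\<phi>\<close> fix
    every x variable, while at y they differ by y - x^X = -\<rho>, so they are congruent modulo
    \<rho>.\<close>
  have diff: "p - ?\<iota> (?\<phi> p) \<in> ideal_gen {\<rho>}" for p
  proof -
    have "Var v - ?\<iota> (case_option (vec_monom X) Var v) \<in> ideal_gen {\<rho>}" for v
    proof (cases v)
      case None
      have "- 1 * \<rho> \<in> ideal_gen {\<rho>}"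
        by (intro ideal_gen_mult ideal_gen_base) simp
      with None show ?thesis
        by (simp add: \<rho>_def glue_binomial_def vec_monom_def subst_poly_prod subst_poly_power)
    qed (simp add: ideal_gen_0)
    then have "subst_poly Var p - subst_poly (\<lambda>v. ?\<iota> (case_option (vec_monom X) Var v)) p \<in> ideal_gen {\<rho>}"
      by (rule subst_poly_diff_in_ideal)
    then show ?thesis
      by (simp add: subst_poly_subst_poly subst_poly_Var_id)
  qed
  have "?IC = ideal_gen (?\<iota> ` toric_ideal A) + ideal_gen {\<rho>}"
  proof
    show "?IC \<subseteq> ideal_gen (?\<iota> ` toric_ideal A) + ideal_gen {\<rho>}"
    proof
      fix p assume "p \<in> ?IC"
      then have "?\<iota> (?\<phi> p) \<in> ideal_gen (?\<iota> ` toric_ideal A)"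
        by (intro ideal_gen_base imageI \<phi>_in)
      \<comment> \<open>The required decomposition is p = \<open>?\<iota> (?\<phi> p)\<close> + (p -
        \<open>?\<iota> (?\<phi> p)\<close>).\<close>
      from set_plus_intro[OF this diff[of p]]
      show "p \<in> ideal_gen (?\<iota> ` toric_ideal A) + ideal_gen {\<rho>}"
        by simp
    qed
    have "ideal_gen (?\<iota> ` toric_ideal A) \<subseteq> ?IC" "ideal_gen {\<rho>} \<subseteq> ?IC"
      using \<iota>_in \<rho>_in by (intro ideal_gen_minimal subspace_toric_ideal image_subsetI; simp)+
    then show "ideal_gen (?\<iota> ` toric_ideal A) + ideal_gen {\<rho>} \<subseteq> ?IC"
      by (blast elim!: set_plus_elim intro: module.subspace_add[OF module_self subspace_toric_ideal])
  qed
  moreover have "\<rho> \<noteq> 0"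
    by (simp add: \<rho>_def glue_binomial_eq_0_iff)
  ultimately have "is_gluing TYPE('k) 1 A d b"
    unfolding is_gluing_def \<rho>_def by blast
  with \<open>d \<ge> 1\<close> show ?thesis
    unfolding can_be_glued_def by (metis less_one less_le_trans zero_less_one)
qed

section \<open>The semigroup as the image of the matrix\<close>

lemma semigroup_gen_columns: "semigroup_gen (columns A) = range ((*v) A)"
  for A :: "nat ^ 'p::finite ^ 'n::finite"
proof
  have column: "c *s column j A \<in> range ((*v) A)" for c j
  proof -
    \<comment> \<open>The witness is c times the j-th unit vector.\<close>
    have "c *s column j A = A *v (\<chi> i. if i = j then c else 0)"
      by (simp add: matrix_vector_mult_def column_def vec_eq_iff if_distrib cong: if_cong)
    then show ?thesis by blast
  qed
  have add: "u + v \<in> range ((*v) A)" if "u \<in> range ((*v) A)" "v \<in> range ((*v) A)" for u v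
    using that by (auto simp flip: matrix_vector_right_distrib)
  have zero: "0 \<in> range ((*v) A)"
    by (metis matrix_vector_mult_0_right rangeI)
  have "(\<Sum>a\<in>F. c a *s a) \<in> range ((*v) A)" if "finite F" "F \<subseteq> columns A" for F c
    using that
  proof (induction F)
    case (insert a F)
    then obtain j where "a = column j A"
      by (auto simp: columns_def)
    with insert show ?case
      using add[OF column] by simp
  qed (simp add: zero)
  then show "semigroup_gen (columns A) \<subseteq> range ((*v) A)"
    by (auto simp: semigroup_gen_def)
  show "range ((*v) A) \<subseteq> semigroup_gen (columns A)"
  proof
    fix v assume "v \<in> range ((*v) A)"
    then obtain X where "v = (\<Sum>j\<in>UNIV. X $ j *s column j A)"
      by (auto simp: matrix_mult_sum)
    \<comment> \<open>Different indices may carry equal columns, whereas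
      \<open>semigroup_gen\<close> assigns one coefficient to each vector. Indices are therefore
      grouped by column and their coefficients added.\<close>
    also have "\<dots> = (\<Sum>a\<in>range (\<lambda>j. column j A). \<Sum>j | j \<in> UNIV \<and> column j A = a. X $ j *s column j A)"
      by (intro sum.image_gen) simp
    also have "\<dots> = (\<Sum>a\<in>columns A. (\<Sum>j | column j A = a. X $ j) *s a)"
      by (intro sum.cong) (auto simp: columns_def vec_eq_iff sum_distrib_right)
    finally show "v \<in> semigroup_gen (columns A)"
      unfolding semigroup_gen_def by (auto simp: columns_def full_SetCompr_eq)
  qed
qed

theorem theorem3p2:
  fixes A :: "nat ^ 'p::finite ^ 'n::finite" and b :: "nat ^ 'n"
  assumes "\<And>j. column j A \<noteq> 0" and "b \<noteq> 0"
  shows "(can_be_glued TYPE('k::field) A b \<longleftrightarrow> (\<exists>d\<ge>1. d *s b \<in> semigroup_gen (columns A))) \<and>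
         (can_be_glued TYPE('k) A b \<longleftrightarrow> (\<exists>d\<ge>1. \<exists>X :: nat ^ 'p. A *v X = d *s b))"
proof -
  have "can_be_glued TYPE('k) A b \<longleftrightarrow> (\<exists>d\<ge>1. \<exists>X. A *v X = d *s b)"
    using can_be_glued_imp_solution[OF assms(1)] solution_imp_can_be_glued by blast
  moreover have "d *s b \<in> semigroup_gen (columns A) \<longleftrightarrow> (\<exists>X. A *v X = d *s b)" for d
    unfolding semigroup_gen_columns by (auto simp: image_iff eq_commute)
  ultimately show ?thesis by simp
qed

end
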